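(* Let $G\in\mathbf{RH}_\infty$ and let $\mathcal{N}$ be either $\mathcal{M}$ or $\mathcal{M}_{\text{odd}}$. The following two statements are equivalent: (a) There is no $M\in\mathcal{N}$ such that $\mathrm{Re}(M(e^{j\omega})G(e^{j\omega}))>0$ for all $\omega\in[0,\pi]$. (b) There exists a nonzero $Z\in\mathbf{P}_{NBV}$ such that $$\int_{-\pi}^{\pi}\mathrm{Re}(M(e^{j\omega})G(e^{j\omega}))\,\mathrm{d}Z(\omega)\le 0\quad\text{for all }M\in\mathcal{N}.$$
   Context: $j$ is the imaginary unit. $\mathbf{RH}_\infty$ is the set of scalar proper rational functions $G(z)$ with real coefficients all of whose poles lie in the open unit disk. For a real two-sided sequence $h=(h_i)_{i\in\mathbb{Z}}$, $\|h\|_1=\sum_{i\in\mathbb{Z}}|h_i|$. Discrete-time LTI Zames-Falb multipliers: $\mathcal{M}$ is the set of functions on the unit circle of the form $M(e^{j\omega})=1-H(e^{j\omega})$, $H(e^{j\omega})=\sum_{i\in\mathbb{Z}}h_ie^{-j\omega i}$, where $h$ is a real sequence with $h_0=0$, $h_i\ge 0$ for all $i$ and $\|h\|_1\le 1$. $\mathcal{M}_{\text{odd}}$ is the set of such functions where $h$ is a real sequence with $h_0=0$ and $\|h\|_1\le 1$ (no sign condition). $\mathbf{P}_{NBV}$ (scalar case) is the set of functions $Z:[-\pi,\pi]\to\mathbb{R}$ that have bounded variation on $[0,\pi]$, satisfy $Z(0)=0$, are right continuous on $(0,\pi)$, satisfy $Z(-\omega)=-Z(\omega)$ for $\omega\in[0,\pi]$,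 and are nondecreasing on $[0,\pi]$, i.e. $Z(\omega_1)\ge Z(\omega_2)$ whenever $\omega_1\ge\omega_2\ge 0$. The integral is a Riemann–Stieltjes integral of a continuous function over $[-\pi,\pi]$ (jumps of $Z$ at $0$ and at $\pm\pi$ are counted). *)

theory Defs
  imports "HOL-Analysis.Analysis" "HOL-Computational_Algebra.Polynomial"
begin

text \<open>The fraction is in lowest terms, so its poles are exactly the complex zeros of the
  denominator. (At the poles the function takes the dummy value \<open>x / 0 = 0\<close>.)\<close>

definition RH_inf :: "(complex \<Rightarrow> complex) set" where
  "RH_inf = {G. \<exists>p q :: real poly.
     q \<noteq> 0 \<and> coprime p q \<and> degree p \<le> degree q \<and>
     (\<forall>z. poly (map_poly complex_of_real q) z = 0 \<longrightarrow> norm z < 1) \<and>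
     (\<forall>z. G z = poly (map_poly complex_of_real p) z / poly (map_poly complex_of_real q) z)}"

text \<open>Functions on the unit circle are rendered as functions on the complex plane whose values
  off the circle are unconstrained.\<close>

definition is_multiplier_of :: "(complex \<Rightarrow> complex) \<Rightarrow> (int \<Rightarrow> real) \<Rightarrow> bool" where
  "is_multiplier_of M h \<longleftrightarrow>
     (\<forall>\<omega>::real. M (cis \<omega>) =
        1 - (\<Sum>\<^sub>\<infinity>i\<in>UNIV. complex_of_real (h i) * cis (- (\<omega> * of_int i))))"

definition l1_norm_le_1 :: "(int \<Rightarrow> real) \<Rightarrow> bool" where
  "l1_norm_le_1 h \<longleftrightarrow>
     (\<lambda>i. \<bar>h i\<bar>) summable_on UNIV \<and> (\<Sum>\<^sub>\<infinity>i\<in>UNIV. \<bar>h i\<bar>) \<le> 1"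

definition zames_falb :: "(complex \<Rightarrow> complex) set" where
  "zames_falb = {M. \<exists>h :: int \<Rightarrow> real.
     h 0 = 0 \<and> (\<forall>i. 0 \<le> h i) \<and> l1_norm_le_1 h \<and> is_multiplier_of M h}"

definition zames_falb_odd :: "(complex \<Rightarrow> complex) set" where
  "zames_falb_odd = {M. \<exists>h :: int \<Rightarrow> real.
     h 0 = 0 \<and> l1_norm_le_1 h \<and> is_multiplier_of M h}"

definition bounded_variation_on :: "(real \<Rightarrow> real) \<Rightarrow> real \<Rightarrow> real \<Rightarrow> bool" where
  "bounded_variation_on Z a b \<longleftrightarrow>
     (\<exists>B. \<forall>D. D division_of {a..b} \<longrightarrow> (\<Sum>K\<in>D. \<bar>Z (Sup K) - Z (Inf K)\<bar>) \<le> B)"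

text \<open>Only the values on \<open>[-\<pi>, \<pi>]\<close> matter.\<close>

definition P_NBV :: "(real \<Rightarrow> real) set" where
  "P_NBV = {Z. bounded_variation_on Z 0 pi \<and> Z 0 = 0 \<and>
     (\<forall>\<omega>\<in>{0<..<pi}. continuous (at_right \<omega>) Z) \<and>
     (\<forall>\<omega>\<in>{0..pi}. Z (- \<omega>) = - Z \<omega>) \<and>
     mono_on {0..pi} Z}"

text \<open>The Riemann--Stieltjes integral of \<open>f\<close> with respect to \<open>g\<close> over \<open>[a, b]\<close> exists and
  equals \<open>I\<close>, as the limit of Riemann--Stieltjes sums when the mesh tends to \<open>0\<close>. Since the sums use
  the values of \<open>g\<close> at \<open>a\<close> and \<open>b\<close>, jumps of \<open>g\<close> at the endpoints are counted.\<close>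

definition has_rs_integral ::
    "(real \<Rightarrow> real) \<Rightarrow> (real \<Rightarrow> real) \<Rightarrow> real \<Rightarrow> real \<Rightarrow> real \<Rightarrow> bool" where
  "has_rs_integral f g a b I \<longleftrightarrow>
     (\<forall>\<epsilon>>0. \<exists>\<delta>>0. \<forall>P. P tagged_division_of {a..b} \<and> (\<forall>(t, K)\<in>P. Sup K - Inf K < \<delta>) \<longrightarrow>
        \<bar>(\<Sum>(t, K)\<in>P. f t * (g (Sup K) - g (Inf K))) - I\<bar> < \<epsilon>)"

end

theory Submission
  imports Defs "HOL-Probability.Helly_Selection" "HOL-Probability.Probability_Mass_Function"
begin

text \<open>
  If some multiplier makes the integrand positive, it is bounded below by a positive constant, so
  the integral against a nonzero \<open>Z\<close> is positive. Conversely, suppose that no multiplier does.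
  The functions \<open>Re (M G)\<close> depend affinely on the coefficients of \<open>M\<close>, so every convex combination
  of finitely many of them is nonpositive somewhere on \<open>[0, \<pi>]\<close>. Playing Blackwell's approachability
  strategy against the extreme multipliers \<open>1\<close> and \<open>1 \<plusminus> z\<^sup>k\<close> yields finitely supported probability
  measures against which more and more of these countably many functions have almost nonpositive
  integral. A weak limit \<open>\<mu>\<close> of these measures has nonpositive integral for all extreme multipliers,
  hence for all multipliers, and \<open>Z\<close> is the odd extension of \<open>x \<mapsto> \<mu> [0, x]\<close>.
\<close>

section \<open>Approachability and weak limits\<close>

text \<open>Energy increment for the approachability argument. For \<open>v \<ge> 0\<close> it comes
  from expanding the square; for \<open>v < 0\<close> the linear term vanishes and the positive part
  of \<open>v + g\<close> is at most \<open>\<bar>g\<bar>\<close>.\<close>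

lemma positive_part_square_add:
  fixes v g :: real
  shows "(max 0 (v + g))\<^sup>2 \<le> (max 0 v)\<^sup>2 + 2 * max 0 v * g + g\<^sup>2"
proof (cases "v \<ge> 0")
  case True
  have "(max 0 (v + g))\<^sup>2 \<le> (v + g)\<^sup>2"
    by (simp add: max_def)
  then show ?thesis using True by (simp add: power2_sum)
next
  case False
  then have "max 0 (v + g) \<le> \<bar>g\<bar>" by auto
  then have "(max 0 (v + g))\<^sup>2 \<le> \<bar>g\<bar>\<^sup>2" by (intro power_mono) auto
  then show ?thesis using False by auto
qed

text \<open>Blackwell's strategy: reply to the weights given by the positive parts of the
  accumulated payoffs. The reply makes the linear term of the energy increment nonpositive, so the
  squared distance of the payoff vector to the nonpositive orthant grows at most linearly in
  \<open>T\<close>. The distance is thus of order sqrt \<open>T\<close>, below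
  \<open>\<epsilon> * T\<close> for large \<open>T\<close>.\<close>

lemma finite_approachability:
  fixes f :: "'i \<Rightarrow> 'x \<Rightarrow> real" and \<epsilon> B :: real
  assumes fin: "finite A"
    and bdd: "\<And>i x. i \<in> A \<Longrightarrow> x \<in> X \<Longrightarrow> \<bar>f i x\<bar> \<le> B"
    and resp: "\<And>w. (\<And>i. i \<in> A \<Longrightarrow> 0 \<le> w i) \<Longrightarrow> \<exists>x\<in>X. (\<Sum>i\<in>A. w i * f i x) \<le> 0"
    and "0 < \<epsilon>"
  obtains T :: nat and \<omega> :: "nat \<Rightarrow> 'x"
  where "0 < T" "\<And>s. \<omega> s \<in> X" "\<And>i. i \<in> A \<Longrightarrow> (\<Sum>s<T. f i (\<omega> s)) \<le> \<epsilon> * T"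
proof -
  \<comment> \<open>Positive parts are admissible weights for every \<open>w\<close>, so a reply can
    be chosen as a total function of the state.\<close>
  have "\<forall>w. \<exists>x\<in>X. (\<Sum>i\<in>A. max 0 (w i) * f i x) \<le> 0"
    by (intro allI resp) auto
  then obtain pick where pick: "\<And>w. pick w \<in> X"
      "\<And>w. (\<Sum>i\<in>A. max 0 (w i) * f i (pick w)) \<le> 0"
    by metis
  \<comment> \<open>\<open>V T\<close> is the vector of payoffs accumulated after \<open>T\<close>
    rounds, each round replying to the current vector.\<close>
  define V :: "nat \<Rightarrow> 'i \<Rightarrow> real" where
    "V = rec_nat (\<lambda>_. 0) (\<lambda>_ v i. v i + f i (pick v))"
  have V0: "V 0 i = 0" and VS: "V (Suc T) i = V T i + f i (pick (V T))" for T i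
    by (auto simp: V_def)
  define \<omega> where "\<omega> T = pick (V T)" for T
  have Vsum: "V T i = (\<Sum>s<T. f i (\<omega> s))" for T i
    by (induction T) (auto simp: V0 VS \<omega>_def)
  define C where "C = card A * B\<^sup>2"
  have energy: "(\<Sum>i\<in>A. (max 0 (V T i))\<^sup>2) \<le> T * C" for T
  proof (induction T)
    case 0
    then show ?case by (simp add: V0)
  next
    case (Suc T)
    have "(\<Sum>i\<in>A. (max 0 (V (Suc T) i))\<^sup>2) \<le>
      (\<Sum>i\<in>A. (max 0 (V T i))\<^sup>2 + 2 * (max 0 (V T i) * f i (\<omega> T)) + B\<^sup>2)"
    proof (rule sum_mono)
      fix i assume "i \<in> A"
      then have "\<bar>f i (\<omega> T)\<bar> \<le> B" using bdd pick(1) by (simp add: \<omega>_def)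
      then have "(f i (\<omega> T))\<^sup>2 \<le> B\<^sup>2" using abs_le_square_iff by fastforce
      then show "(max 0 (V (Suc T) i))\<^sup>2 \<le>
          (max 0 (V T i))\<^sup>2 + 2 * (max 0 (V T i) * f i (\<omega> T)) + B\<^sup>2"
        using positive_part_square_add[of "V T i" "f i (\<omega> T)"] by (simp add: VS \<omega>_def)
    qed
    also have "\<dots> = (\<Sum>i\<in>A. (max 0 (V T i))\<^sup>2) +
        2 * (\<Sum>i\<in>A. max 0 (V T i) * f i (\<omega> T)) + C"
      by (simp add: sum.distrib sum_distrib_left C_def)
    also have "\<dots> \<le> T * C + C" using Suc pick(2)[of "V T"] by (simp add: \<omega>_def)
    finally show ?case by (simp add: algebra_simps)
  qed
  \<comment> \<open>Once \<open>T\<close> is at least \<open>C / \<epsilon>\<^sup>2\<close>, the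
    energy bound \<open>T * C\<close> is at most \<open>(\<epsilon> * T)\<^sup>2\<close>.\<close>
  obtain T0 :: nat where T0: "C / \<epsilon>\<^sup>2 < T0" using reals_Archimedean2 by blast
  define T where "T = Suc T0"
  have TC: "C \<le> \<epsilon>\<^sup>2 * T" using T0 \<open>0 < \<epsilon>\<close> by (simp add: T_def field_simps add_increasing)
  have "V T i \<le> \<epsilon> * T" if "i \<in> A" for i
  proof -
    have "(max 0 (V T i))\<^sup>2 \<le> (\<Sum>i\<in>A. (max 0 (V T i))\<^sup>2)"
      using fin that by (intro member_le_sum) auto
    also have "\<dots> \<le> T * C" by (rule energy)
    also have "\<dots> \<le> T * (\<epsilon>\<^sup>2 * T)" using TC by (intro mult_left_mono) auto
    also have "\<dots> = (\<epsilon> * T)\<^sup>2" by (simp add: power2_eq_square)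
    finally have "max 0 (V T i) \<le> \<epsilon> * T"
      by (rule power2_le_imp_le) (use \<open>0 < \<epsilon>\<close> in simp)
    then show ?thesis by simp
  qed
  then show thesis
    using that[of T \<omega>] pick(1) by (simp add: Vsum T_def \<omega>_def)
qed

text \<open>The measure number \<open>m\<close> is the empirical distribution of a play against
  \<open>f 0\<close>, ..., \<open>f m\<close> with tolerance \<open>1 / (m + 1)\<close>. All these
  measures live on one compact interval, so a subsequence converges weakly. Each fixed
  \<open>f n\<close> is controlled by all but finitely many of them, with tolerance tending to
  0.\<close>

lemma countable_alternative_measure:
  fixes f :: "nat \<Rightarrow> real \<Rightarrow> real"
  assumes cont: "\<And>n x. isCont (f n) x"
    and bdd: "\<And>n x. \<bar>f n x\<bar> \<le> B"
    and resp: "\<And>A w. finite A \<Longrightarrow> (\<And>n. n \<in> A \<Longrightarrow> 0 \<le> w n) \<Longrightarrow>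
        \<exists>x\<in>{a..b}. (\<Sum>n\<in>A. w n * f n x) \<le> 0"
  obtains M where "real_distribution M" "AE x in M. x \<in> {a..b}"
    "\<And>n. (\<integral>x. f n x \<partial>M) \<le> 0"
proof -
  have "\<exists>T \<omega>. 0 < T \<and> (\<forall>s. \<omega> s \<in> {a..b}) \<and>
      (\<forall>n\<in>{..m}. (\<Sum>s<T. f n (\<omega> s)) \<le> inverse (real (Suc m)) * real T)" for m
  proof -
    obtain T \<omega> where "0 < T" "\<And>s. \<omega> s \<in> {a..b}"
      "\<And>n. n \<in> {..m} \<Longrightarrow> (\<Sum>s<T. f n (\<omega> s)) \<le> inverse (real (Suc m)) * real T"
    proof (rule finite_approachability[of "{..m}" "{a..b}" f B "inverse (real (Suc m))"])
      show "\<exists>x\<in>{a..b}. (\<Sum>n\<in>{..m}. w n * f n x) \<le> 0" if "\<And>n. n \<in> {..m} \<Longrightarrow> 0 \<le> w n" for w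
        by (rule resp) (use that in auto)
    qed (use bdd in auto)
    then show ?thesis by blast
  qed
  then obtain T \<omega> where T: "\<And>m. 0 < T m" and \<omega>: "\<And>m s. \<omega> m s \<in> {a..b}"
    and avg: "\<And>m n. n \<le> m \<Longrightarrow> (\<Sum>s<T m. f n (\<omega> m s)) \<le> inverse (real (Suc m)) * real (T m)"
    unfolding atMost_iff Ball_def by metis
  define \<mu> where "\<mu> m = distr (measure_pmf (pmf_of_set {..<T m})) borel (\<omega> m)" for m
  have fn[simp]: "finite {..<T m}" "{..<T m} \<noteq> {}" for m using T[of m] by auto
  have \<mu>D: "real_distribution (\<mu> m)" for m
    unfolding \<mu>_def by (intro prob_space.real_distribution_distr) (auto simp: measure_pmf.prob_space_axioms)
  have \<mu>int: "(\<integral>x. g x \<partial>\<mu> m) = (\<Sum>s<T m. g (\<omega> m s)) / T m"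
    if "g \<in> borel_measurable borel" for g :: "real \<Rightarrow> real" and m
    using that unfolding \<mu>_def by (subst integral_distr) (auto simp: integral_pmf_of_set)
  \<comment> \<open>Tightness is phrased with intervals open on the left; starting at
    \<open>a - 1\<close> keeps possible mass at \<open>a\<close>.\<close>
  have "measure (\<mu> m) {a - 1<..b} = 1" for m
  proof -
    have "\<omega> m -` {a - 1<..b} = UNIV" using \<omega>[of m] by force
    then show ?thesis unfolding \<mu>_def by (subst measure_distr) auto
  qed
  moreover have "a \<le> b" using \<omega>[of 0 0] by auto
  ultimately have "tight \<mu>"
    unfolding tight_def using \<mu>D
    by (intro conjI allI impI exI[where x = "a - 1"] exI[where x = b]) auto
  then obtain r M where r: "strict_mono r" and M: "real_distribution M"
    and wc: "weak_conv_m (\<mu> \<circ> id \<circ> r) M"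
    using tight_imp_convergent_subsubsequence[of \<mu> id] by (auto simp: strict_mono_def)
  interpret M: real_distribution M by fact
  have conv: "(\<lambda>k. (\<Sum>s<T (r k). g (\<omega> (r k) s)) / T (r k)) \<longlonglongrightarrow> (\<integral>x. g x \<partial>M)"
    if g: "\<And>x. isCont g x" "\<And>x. norm (g x) \<le> C" for g :: "real \<Rightarrow> real" and C
  proof -
    have "g \<in> borel_measurable borel"
      using g(1) by (intro borel_measurable_continuous_onI) (simp add: continuous_at_imp_continuous_on)
    moreover have "(\<lambda>k. \<integral>x. g x \<partial>(\<mu> \<circ> id \<circ> r) k) \<longlonglongrightarrow> (\<integral>x. g x \<partial>M)"
      using \<mu>D M wc g by (intro weak_conv_imp_integral_bdd_continuous_conv) (auto simp: o_def)
    ultimately show ?thesis by (simp add: \<mu>int)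
  qed
  have "(\<integral>x. f n x \<partial>M) \<le> 0" for n
  proof (rule LIMSEQ_le)
    show "(\<lambda>k. (\<Sum>s<T (r k). f n (\<omega> (r k) s)) / T (r k)) \<longlonglongrightarrow> (\<integral>x. f n x \<partial>M)"
      using cont bdd by (intro conv) auto
    show "(\<lambda>k. inverse (real (Suc (r k)))) \<longlonglongrightarrow> 0"
      using LIMSEQ_subseq_LIMSEQ[OF LIMSEQ_inverse_real_of_nat r] by (simp add: o_def)
    show "\<exists>N. \<forall>k\<ge>N. (\<Sum>s<T (r k). f n (\<omega> (r k) s)) / T (r k) \<le> inverse (real (Suc (r k)))"
    proof (intro exI allI impI)
      fix k assume "n \<le> k"
      then have "n \<le> r k" using seq_suble[OF r, of k] by simp
      then show "(\<Sum>s<T (r k). f n (\<omega> (r k) s)) / T (r k) \<le> inverse (real (Suc (r k)))"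
        using avg[of n "r k"] T[of "r k"] by (simp add: pos_divide_le_eq)
    qed
  qed
  moreover have "AE x in M. x \<in> {a..b}"
  proof -
    \<comment> \<open>A bounded continuous test function that vanishes exactly on the interval. Its
      averages along the sequence are 0, so weak convergence forces its limit integral to be 0 and
      the limit to be carried by the interval.\<close>
    define g where "g x = min 1 (infdist x {a..b})" for x
    have gc: "isCont g x" for x
      unfolding g_def by (intro continuous_intros)
    have gb: "norm (g x) \<le> 1" for x by (simp add: g_def infdist_nonneg)
    have [measurable]: "g \<in> borel_measurable borel"
      using gc by (intro borel_measurable_continuous_onI) (simp add: continuous_at_imp_continuous_on)
    have "g (\<omega> m s) = 0" for m s using \<omega>[of m s] by (simp add: g_def)
    then have "(\<integral>x. g x \<partial>M) = 0"
      using conv[OF gc gb] by (simp add: LIMSEQ_const_iff)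
    moreover have "integrable M g"
      using gb by (intro M.integrable_const_bound[of _ 1]) auto
    ultimately have "AE x in M. g x = 0"
      by (subst (asm) integral_nonneg_eq_0_iff_AE) (auto simp: g_def infdist_nonneg)
    then show ?thesis
    proof eventually_elim
      case (elim x)
      then have "infdist x {a..b} = 0" by (auto simp: g_def min_def split: if_splits)
      then show ?case using \<open>a \<le> b\<close> in_closed_iff_infdist_zero[of "{a..b}" x] by auto
    qed
  qed
  ultimately show thesis using that M by blast
qed

section \<open>Riemann--Stieltjes integrals\<close>

lemma tagged_division_of_realE:
  fixes a b :: real
  assumes "P tagged_division_of {a..b}" "(t, K) \<in> P"
  obtains u v where "K = {u..v}" "Inf K = u" "Sup K = v" "a \<le> u" "u \<le> t" "t \<le> v" "v \<le> b"
proof -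
  obtain u v where K: "K = cbox u v" using tagged_division_ofD(4)[OF assms] by blast
  moreover have "t \<in> K" "K \<subseteq> {a..b}" using tagged_division_ofD(2,3)[OF assms] .
  ultimately show thesis using that[of u v] by auto
qed

text \<open>Monotonicity of \<open>g\<close> makes the increments nonnegative, so each
  Riemann-Stieltjes sum dominates the telescoping sum with \<open>f\<close> replaced by
  \<open>c\<close>. A division of small mesh exists by Cousin's lemma, and its sum is close to
  \<open>I\<close>.\<close>

lemma has_rs_integral_lower_bound:
  assumes I: "has_rs_integral f g a b I" and "a \<le> b"
    and mono: "mono_on {a..b} g" and c: "\<And>t. t \<in> {a..b} \<Longrightarrow> c \<le> f t"
  shows "c * (g b - g a) \<le> I"
proof (rule field_le_epsilon)
  fix \<epsilon> :: real assume "0 < \<epsilon>"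
  with I obtain \<delta> where "0 < \<delta>" and \<delta>: "\<forall>P. P tagged_division_of {a..b} \<and>
      (\<forall>(t, K)\<in>P. Sup K - Inf K < \<delta>) \<longrightarrow>
      \<bar>(\<Sum>(t, K)\<in>P. f t * (g (Sup K) - g (Inf K))) - I\<bar> < \<epsilon>"
    unfolding has_rs_integral_def by meson
  \<comment> \<open>Both endpoints of a cell lie within \<open>\<delta> / 2\<close> of its tag, so
    its length is below \<open>\<delta>\<close>.\<close>
  obtain P where P: "P tagged_division_of {a..b}" and fine: "(\<lambda>x. ball x (\<delta> / 2)) fine P"
    using fine_division_exists_real[OF gauge_ball, of "\<delta> / 2" a b] \<open>0 < \<delta>\<close> by auto
  have "Sup K - Inf K < \<delta>" if tK: "(t, K) \<in> P" for t K
  proof -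
    obtain u v where uv: "K = {u..v}" "Inf K = u" "Sup K = v" "u \<le> t" "t \<le> v"
      using tagged_division_of_realE[OF P tK] by metis
    then have "u \<in> ball t (\<delta> / 2)" "v \<in> ball t (\<delta> / 2)" using fineD[OF fine tK] by (simp_all add: subset_iff)
    then show ?thesis using uv by (auto simp: dist_real_def)
  qed
  then have "\<bar>(\<Sum>(t, K)\<in>P. f t * (g (Sup K) - g (Inf K))) - I\<bar> < \<epsilon>"
    using P by (intro \<delta>[rule_format]) auto
  moreover have "c * (g b - g a) \<le> (\<Sum>(t, K)\<in>P. f t * (g (Sup K) - g (Inf K)))"
  proof -
    have "c * (g b - g a) = (\<Sum>(t, K)\<in>P. c * (g (Sup K) - g (Inf K)))"
      using additive_tagged_division_1[OF \<open>a \<le> b\<close> P, of g]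
      by (simp add: sum_distrib_left [symmetric] case_prod_unfold)
    also have "\<dots> \<le> (\<Sum>(t, K)\<in>P. f t * (g (Sup K) - g (Inf K)))"
    proof (rule sum_mono, clarify)
      fix t K assume tK: "(t, K) \<in> P"
      obtain u v where uv: "Inf K = u" "Sup K = v" "a \<le> u" "u \<le> t" "t \<le> v" "v \<le> b"
        using tagged_division_of_realE[OF P tK] by metis
      then show "c * (g (Sup K) - g (Inf K)) \<le> f t * (g (Sup K) - g (Inf K))"
        using mono_onD[OF mono, of u v] c[of t] by (intro mult_right_mono) auto
    qed
    finally show ?thesis .
  qed
  ultimately show "c * (g b - g a) \<le> I + \<epsilon>" by linarith
qed

text \<open>\<open>\<Phi>\<close> plays the role of an indefinite integral. The error on each cell
  is at most \<open>\<epsilon>\<close> times the increment of \<open>g\<close>, and these increments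
  telescope, so the total error is at most \<open>\<epsilon> * (g b - g a)\<close>.\<close>

lemma has_rs_integral_antiderivative:
  assumes "a \<le> b"
    and approx: "\<And>\<epsilon>. 0 < \<epsilon> \<Longrightarrow> \<exists>\<delta>>0. \<forall>u t v. a \<le> u \<and> u \<le> t \<and> t \<le> v \<and> v \<le> b \<and> v - u < \<delta> \<longrightarrow>
        \<bar>f t * (g v - g u) - (\<Phi> v - \<Phi> u)\<bar> \<le> \<epsilon> * (g v - g u)"
  shows "has_rs_integral f g a b (\<Phi> b - \<Phi> a)"
  unfolding has_rs_integral_def
proof (intro allI impI)
  fix \<epsilon> :: real assume "0 < \<epsilon>"
  \<comment> \<open>The summand 1 keeps the denominator positive and makes the final estimate
    strict, also when \<open>g b = g a\<close>.\<close>
  define \<epsilon>' where "\<epsilon>' = \<epsilon> / (\<bar>g b - g a\<bar> + 1)"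
  have "0 < \<epsilon>'" using \<open>0 < \<epsilon>\<close> by (simp add: \<epsilon>'_def add_nonneg_pos)
  then obtain \<delta> where "0 < \<delta>" and \<delta>: "\<And>u t v. a \<le> u \<Longrightarrow> u \<le> t \<Longrightarrow> t \<le> v \<Longrightarrow> v \<le> b \<Longrightarrow> v - u < \<delta> \<Longrightarrow>
        \<bar>f t * (g v - g u) - (\<Phi> v - \<Phi> u)\<bar> \<le> \<epsilon>' * (g v - g u)"
    using approx by metis
  show "\<exists>\<delta>>0. \<forall>P. P tagged_division_of {a..b} \<and> (\<forall>(t, K)\<in>P. Sup K - Inf K < \<delta>) \<longrightarrow>
      \<bar>(\<Sum>(t, K)\<in>P. f t * (g (Sup K) - g (Inf K))) - (\<Phi> b - \<Phi> a)\<bar> < \<epsilon>"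
  proof (intro exI[of _ \<delta>] conjI allI impI \<open>0 < \<delta>\<close>, elim conjE)
    fix P assume P: "P tagged_division_of {a..b}" and mesh: "\<forall>(t, K)\<in>P. Sup K - Inf K < \<delta>"
    have "(\<Sum>(t, K)\<in>P. f t * (g (Sup K) - g (Inf K))) - (\<Phi> b - \<Phi> a) =
        (\<Sum>(t, K)\<in>P. f t * (g (Sup K) - g (Inf K)) - (\<Phi> (Sup K) - \<Phi> (Inf K)))"
      using additive_tagged_division_1[OF \<open>a \<le> b\<close> P, of \<Phi>]
      by (simp add: sum_subtractf case_prod_unfold)
    also have "\<bar>\<dots>\<bar> \<le> (\<Sum>(t, K)\<in>P. \<epsilon>' * (g (Sup K) - g (Inf K)))"
    proof (rule order_trans[OF sum_abs], rule sum_mono, clarify)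
      fix t K assume tK: "(t, K) \<in> P"
      obtain u v where uv: "Inf K = u" "Sup K = v" "a \<le> u" "u \<le> t" "t \<le> v" "v \<le> b"
        using tagged_division_of_realE[OF P tK] by metis
      then show "\<bar>f t * (g (Sup K) - g (Inf K)) - (\<Phi> (Sup K) - \<Phi> (Inf K))\<bar>
          \<le> \<epsilon>' * (g (Sup K) - g (Inf K))"
        using \<delta>[of u t v] mesh tK by auto
    qed
    also have "\<dots> = \<epsilon>' * (g b - g a)"
      using additive_tagged_division_1[OF \<open>a \<le> b\<close> P, of g]
      by (simp add: sum_distrib_left [symmetric] case_prod_unfold)
    also have "\<dots> < \<epsilon>' * (\<bar>g b - g a\<bar> + 1)"
      using \<open>0 < \<epsilon>'\<close> by (intro mult_strict_left_mono) auto
    also have "\<dots> = \<epsilon>"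
      using add_nonneg_pos[of "\<bar>g b - g a\<bar>" 1] by (simp add: \<epsilon>'_def)
    finally show "\<bar>(\<Sum>(t, K)\<in>P. f t * (g (Sup K) - g (Inf K))) - (\<Phi> b - \<Phi> a)\<bar> < \<epsilon>" .
  qed
qed

section \<open>Odd extensions of distribution functions\<close>

text \<open>The value at 0 is 0 even if \<open>F 0\<close> is not: an atom of the measure at 0 then
  shows up as two jumps, one on each side of the origin.\<close>

definition odd_extension :: "(real \<Rightarrow> real) \<Rightarrow> real \<Rightarrow> real" where
  "odd_extension F x = (if 0 < x then F x else if x < 0 then - F (- x) else 0)"

lemma odd_extension_0 [simp]: "odd_extension F 0 = 0"
  and odd_extension_minus [simp]: "odd_extension F (- x) = - odd_extension F x"
  by (auto simp: odd_extension_def)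

text \<open>The indefinite integral is the odd extension of the integral of \<open>f\<close> over
  \<open>{0..x}\<close>. Since \<open>f\<close> is even, each half of the interval contributes the
  full integral over \<open>M\<close>, whence the factor 2.\<close>

lemma (in real_distribution) has_rs_integral_odd_extension:
  fixes f :: "real \<Rightarrow> real"
  assumes "0 < b" and supp: "AE x in M. x \<in> {0..b}"
    and cont: "\<And>x. isCont f x" and bdd: "\<And>x. \<bar>f x\<bar> \<le> B" and even: "\<And>x. f (- x) = f x"
  shows "has_rs_integral f (odd_extension (\<lambda>x. measure M {0..x})) (- b) b (2 * (\<integral>x. f x \<partial>M))"
proof -
  define Z where "Z = odd_extension (\<lambda>x. measure M {0..x})"
  define \<Phi> where "\<Phi> = odd_extension (\<lambda>x. \<integral>y. indicator {0..x} y * f y \<partial>M)"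
  have [measurable]: "f \<in> borel_measurable borel"
    using cont by (intro borel_measurable_continuous_onI) (simp add: continuous_at_imp_continuous_on)
  have int: "integrable M (\<lambda>y. indicator S y * f y)" if [measurable]: "S \<in> sets borel" for S
    using bdd order_trans[OF abs_ge_zero bdd]
    by (intro integrable_const_bound[of _ B]) (auto simp: indicator_def)
  have int1: "integrable M (indicator S :: real \<Rightarrow> real)" if [measurable]: "S \<in> sets borel" for S
    by (intro integrable_const_bound[of _ 1]) (auto simp: indicator_def)
  have ind: "(\<integral>y. indicator S y \<partial>M) = measure M S" if "S \<in> sets borel" for S
    using that by simp
  \<comment> \<open>A constant \<open>c\<close> stands in for the value at the tag, so the bound
    applies to both pieces of a cell containing 0, whichever piece holds the tag.\<close>
  have pos: "\<bar>c * (Z v - Z u) - (\<Phi> v - \<Phi> u)\<bar> \<le> \<epsilon> * (Z v - Z u)"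
    if uv: "0 \<le> u" "u \<le> v" and c: "\<And>s. s \<in> {u..v} \<Longrightarrow> \<bar>c - f s\<bar> \<le> \<epsilon>" for u v c \<epsilon>
  proof -
    \<comment> \<open>The set whose mass is the increment from \<open>u\<close> to \<open>v\<close>.
      For \<open>u = 0 < v\<close> it includes 0, as the odd extension jumps from 0 to
      \<open>measure M {0}\<close> there.\<close>
    define S where "S = (if v = 0 then {} else if u = 0 then {0..v} else {u<..v})"
    have [measurable]: "S \<in> sets borel" by (auto simp: S_def)
    have Suv: "S \<subseteq> {u..v}" by (auto simp: S_def)
    have "Z v - Z u = measure M S"
    proof -
      have "measure M {0..v} - measure M {0..u} = measure M {u<..v}"
        using uv by (subst finite_measure_Diff[symmetric]) (auto intro: arg_cong[where f="measure M"])
      then show ?thesis using uv by (auto simp: Z_def odd_extension_def S_def)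
    qed
    then have Z: "Z v - Z u = (\<integral>y. indicator S y \<partial>M)" by (simp add: ind)
    have \<Phi>: "\<Phi> v - \<Phi> u = (\<integral>y. indicator S y * f y \<partial>M)"
    proof -
      have "(\<integral>y. indicator {0..v} y * f y \<partial>M) - (\<integral>y. indicator {0..u} y * f y \<partial>M) =
          (\<integral>y. indicator {u<..v} y * f y \<partial>M)"
        using uv by (subst Bochner_Integration.integral_diff[OF int int, symmetric])
          (auto intro!: Bochner_Integration.integral_cong simp: indicator_def)
      then show ?thesis using uv by (auto simp: \<Phi>_def odd_extension_def S_def)
    qed
    have "c * (Z v - Z u) - (\<Phi> v - \<Phi> u) = (\<integral>y. c * indicator S y - indicator S y * f y \<partial>M)"
      unfolding Z \<Phi> using int1 int by (subst Bochner_Integration.integral_diff) auto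
    also have "\<bar>\<dots>\<bar> \<le> (\<integral>y. \<bar>c * indicator S y - indicator S y * f y\<bar> \<partial>M)"
      by (rule integral_abs_bound)
    also have "\<dots> \<le> (\<integral>y. \<epsilon> * indicator S y \<partial>M)"
    proof (rule integral_mono)
      show "\<bar>c * indicator S y - indicator S y * f y\<bar> \<le> \<epsilon> * indicator S y" for y
        using c Suv by (auto simp: indicator_def)
    qed (simp_all add: int int1)
    also have "\<dots> = \<epsilon> * (Z v - Z u)" by (simp add: Z)
    finally show ?thesis .
  qed
  have Zm: "Z (- x) = - Z x" and \<Phi>m: "\<Phi> (- x) = - \<Phi> x" for x by (auto simp: Z_def \<Phi>_def)
  have Z0: "Z 0 = 0" "\<Phi> 0 = 0" by (auto simp: Z_def \<Phi>_def)
  have general: "\<bar>c * (Z v - Z u) - (\<Phi> v - \<Phi> u)\<bar> \<le> \<epsilon> * (Z v - Z u)"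
    if uv: "u \<le> v" and c: "\<And>s. s \<in> {u..v} \<Longrightarrow> \<bar>c - f s\<bar> \<le> \<epsilon>" for u v c \<epsilon>
  proof -
    \<comment> \<open>Evenness of \<open>f\<close> moves the bound to the reflected cell, so parts
      left of 0 reduce to \<open>pos\<close>; a cell across 0 is split there.\<close>
    have cm: "\<bar>c - f s\<bar> \<le> \<epsilon>" if "- s \<in> {u..v}" for s using c[OF that] even by simp
    consider "0 \<le> u" | "v \<le> 0" | "u < 0" "0 < v" by linarith
    then show ?thesis
    proof cases
      case 1
      then show ?thesis using pos uv c by blast
    next
      case 2
      have "\<bar>c * (Z (- u) - Z (- v)) - (\<Phi> (- u) - \<Phi> (- v))\<bar> \<le> \<epsilon> * (Z (- u) - Z (- v))"
        using 2 uv by (intro pos cm) auto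
      then show ?thesis by (simp add: Zm \<Phi>m)
    next
      case 3
      have "\<bar>c * (Z v - Z 0) - (\<Phi> v - \<Phi> 0)\<bar> \<le> \<epsilon> * (Z v - Z 0)"
        using 3 uv by (intro pos c) auto
      moreover have "\<bar>c * (Z (- u) - Z 0) - (\<Phi> (- u) - \<Phi> 0)\<bar> \<le> \<epsilon> * (Z (- u) - Z 0)"
        using 3 uv by (intro pos cm) auto
      ultimately show ?thesis by (simp add: Zm \<Phi>m Z0 algebra_simps)
    qed
  qed
  have "has_rs_integral f Z (- b) b (\<Phi> b - \<Phi> (- b))"
  proof (rule has_rs_integral_antiderivative)
    fix \<epsilon> :: real assume "0 < \<epsilon>"
    have "uniformly_continuous_on {- b..b} f"
      using cont by (intro compact_uniformly_continuous) (auto simp: continuous_at_imp_continuous_on)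
    then obtain \<delta> where "0 < \<delta>" and \<delta>: "\<And>x y. x \<in> {- b..b} \<Longrightarrow> y \<in> {- b..b} \<Longrightarrow> \<bar>x - y\<bar> < \<delta> \<Longrightarrow> \<bar>f x - f y\<bar> < \<epsilon>"
      unfolding uniformly_continuous_on_def dist_real_def using \<open>0 < \<epsilon>\<close> by (metis abs_minus_commute)
    have "\<bar>f t * (Z v - Z u) - (\<Phi> v - \<Phi> u)\<bar> \<le> \<epsilon> * (Z v - Z u)"
      if "- b \<le> u" "u \<le> t" "t \<le> v" "v \<le> b" "v - u < \<delta>" for u t v
    proof (rule general)
      show "\<bar>f t - f s\<bar> \<le> \<epsilon>" if "s \<in> {u..v}" for s
        using that \<open>- b \<le> u\<close> \<open>u \<le> t\<close> \<open>t \<le> v\<close> \<open>v \<le> b\<close> \<open>v - u < \<delta>\<close>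
        by (intro less_imp_le[OF \<delta>]) (auto simp: abs_real_def)
    qed (use that in simp)
    then show "\<exists>\<delta>>0. \<forall>u t v. - b \<le> u \<and> u \<le> t \<and> t \<le> v \<and> v \<le> b \<and> v - u < \<delta> \<longrightarrow>
        \<bar>f t * (Z v - Z u) - (\<Phi> v - \<Phi> u)\<bar> \<le> \<epsilon> * (Z v - Z u)"
      using \<open>0 < \<delta>\<close> by blast
  qed (use \<open>0 < b\<close> in simp)
  moreover have "(\<integral>y. indicator {0..b} y * f y \<partial>M) = (\<integral>y. f y \<partial>M)"
    using supp by (intro integral_cong_AE) auto
  ultimately show ?thesis using \<open>0 < b\<close> by (simp add: \<Phi>m Z_def) (simp add: \<Phi>_def odd_extension_def)
qed

text \<open>For monotone \<open>Z\<close> the absolute values drop out and the sum telescopes.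
  Tagging each cell with its left endpoint makes additivity over tagged divisions available.\<close>

lemma bounded_variation_on_mono:
  assumes "mono_on {a..b} Z" "a \<le> b"
  shows "bounded_variation_on Z a b"
  unfolding bounded_variation_on_def
proof (intro exI allI impI)
  fix D assume D: "D division_of {a..b}"
  have "(\<Sum>K\<in>D. \<bar>Z (Sup K) - Z (Inf K)\<bar>) = (\<Sum>K\<in>D. Z (Sup K) - Z (Inf K))"
  proof (rule sum.cong, rule refl)
    fix K assume "K \<in> D"
    then obtain u v where "K = cbox u v" "K \<noteq> {}" "K \<subseteq> {a..b}"
      using division_ofD(2,3,4)[OF D] by metis
    then show "\<bar>Z (Sup K) - Z (Inf K)\<bar> = Z (Sup K) - Z (Inf K)"
      using mono_onD[OF assms(1), of u v] by auto
  qed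
  also have "\<dots> = (\<Sum>(t, K)\<in>(\<lambda>K. (Inf K, K)) ` D. Z (Sup K) - Z (Inf K))"
    by (subst sum.reindex) (auto simp: inj_on_def)
  also have "\<dots> = Z b - Z a"
  proof (rule additive_tagged_division_1[OF assms(2)], rule tagged_division_ofI)
    show "finite ((\<lambda>K. (Inf K, K)) ` D)" using division_ofD(1)[OF D] by simp
    show "\<Union>{K. \<exists>x. (x, K) \<in> (\<lambda>K. (Inf K, K)) ` D} = {a..b}"
      using division_ofD(6)[OF D] by (auto simp: image_iff)
    fix t K assume "(t, K) \<in> (\<lambda>K. (Inf K, K)) ` D"
    then have K: "K \<in> D" "t = Inf K" by auto
    then obtain u v where "K = cbox u v" "K \<noteq> {}" using division_ofD(3,4)[OF D] by metis
    then show "t \<in> K" "\<exists>u v. K = cbox u v" using K by auto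
    show "K \<subseteq> {a..b}" using division_ofD(2)[OF D K(1)] .
    fix t' K' assume "(t', K') \<in> (\<lambda>K. (Inf K, K)) ` D" "(t, K) \<noteq> (t', K')"
    then show "interior K \<inter> interior K' = {}" using K division_ofD(5)[OF D] by auto
  qed
  finally show "(\<Sum>K\<in>D. \<bar>Z (Sup K) - Z (Inf K)\<bar>) \<le> Z b - Z a" by simp
qed

text \<open>On the positive axis the odd extension differs from the cumulative distribution function
  by the constant \<open>measure M {..<0}\<close>, so right continuity is inherited.\<close>

lemma (in real_distribution) odd_extension_in_P_NBV:
  "odd_extension (\<lambda>x. measure M {0..x}) \<in> P_NBV"
proof -
  let ?Z = "odd_extension (\<lambda>x. measure M {0..x})"
  have mono: "mono_on {0..pi} ?Z"
    by (rule mono_onI) (auto simp: odd_extension_def intro!: finite_measure_mono)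
  have "continuous (at_right x) ?Z" if "0 < x" for x
  proof -
    have "continuous (at_right x) (\<lambda>y. cdf M y - measure M {..<0})"
      by (intro continuous_intros cdf_is_right_cont)
    moreover have "eventually (\<lambda>y. cdf M y - measure M {..<0} = ?Z y) (at_right x)"
    proof (rule eventually_at_rightI[of _ "x + 1"])
      fix y assume "y \<in> {x<..<x + 1}"
      then have "0 < y" using that by simp
      then have "{0..y} = {..y} - {..<0}" "{..<0} \<subseteq> {..y}" by auto
      then show "cdf M y - measure M {..<0} = ?Z y"
        using \<open>0 < y\<close> by (simp add: odd_extension_def cdf_def finite_measure_Diff)
    qed simp
    moreover have "cdf M x - measure M {..<0} = ?Z x"
    proof -
      have "{0..x} = {..x} - {..<0}" "{..<0} \<subseteq> {..x}" using that by auto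
      then show ?thesis
        using that by (simp add: odd_extension_def cdf_def finite_measure_Diff)
    qed
    ultimately show ?thesis
      unfolding continuous_within using Lim_transform_eventually by fastforce
  qed
  then show ?thesis
    unfolding P_NBV_def using mono bounded_variation_on_mono[OF mono] by auto
qed

section \<open>Multipliers\<close>

text \<open>\<open>P\<close> is the sign constraint: \<open>{0..}\<close> yields the Zames-Falb
  class and \<open>UNIV\<close> the odd class, so both are treated at once.\<close>

definition multiplier_coeffs :: "real set \<Rightarrow> (int \<Rightarrow> real) set" where
  "multiplier_coeffs P = {h. h 0 = 0 \<and> (\<forall>i. h i \<in> P) \<and> l1_norm_le_1 h}"

definition transfer :: "(int \<Rightarrow> real) \<Rightarrow> real \<Rightarrow> complex" where
  "transfer h \<omega> = (\<Sum>\<^sub>\<infinity>i\<in>UNIV. complex_of_real (h i) * cis (- (\<omega> * of_int i)))"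

definition loop_gain :: "(complex \<Rightarrow> complex) \<Rightarrow> (int \<Rightarrow> real) \<Rightarrow> real \<Rightarrow> real" where
  "loop_gain G h \<omega> = Re ((1 - transfer h \<omega>) * G (cis \<omega>))"

lemma zames_falb_eq_multiplier_coeffs: "zames_falb = {M. \<exists>h\<in>multiplier_coeffs {0..}. is_multiplier_of M h}"
  and zames_falb_odd_eq_multiplier_coeffs: "zames_falb_odd = {M. \<exists>h\<in>multiplier_coeffs UNIV. is_multiplier_of M h}"
  by (auto simp: zames_falb_def zames_falb_odd_def multiplier_coeffs_def)

lemma is_multiplier_of_iff: "is_multiplier_of M h \<longleftrightarrow> (\<forall>\<omega>. M (cis \<omega>) = 1 - transfer h \<omega>)"
  by (simp add: is_multiplier_of_def transfer_def)

text \<open>The series depends on the angle only through the point of the circle, since its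
  exponents are integers; hence any choice of argument works.\<close>

lemma multiplier_exists:
  obtains M where "is_multiplier_of M h"
proof
  show "is_multiplier_of (\<lambda>z. 1 - transfer h (Arg z)) h"
    unfolding is_multiplier_of_iff
  proof
    fix \<omega>
    have "cis (Arg (cis \<omega>)) = cis \<omega>" by (simp add: cis_Arg_unique cis_Arg)
    then have "cis (- (Arg (cis \<omega>) * of_int i)) = cis (- (\<omega> * of_int i))" for i
      by (metis cis_power_int cis_inverse mult.commute mult_minus_right of_int_minus power_int_minus)
    then show "1 - transfer h (Arg (cis \<omega>)) = 1 - transfer h \<omega>"
      by (simp add: transfer_def)
  qed
qed

lemma multiplier_coeffs_abs_summable: "h \<in> multiplier_coeffs P \<Longrightarrow> (\<lambda>i. \<bar>h i\<bar>) summable_on UNIV"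
  by (simp add: multiplier_coeffs_def l1_norm_le_1_def)

lemma transfer_has_sum:
  assumes "h \<in> multiplier_coeffs P"
  shows "((\<lambda>i. complex_of_real (h i) * cis (- (\<omega> * of_int i))) has_sum transfer h \<omega>) UNIV"
  unfolding transfer_def
  by (rule has_sum_infsum[OF abs_summable_summable])
    (simp add: norm_mult multiplier_coeffs_abs_summable[OF assms])

text \<open>Weierstrass M-test with majorant \<open>\<bar>h i\<bar>\<close>. It yields continuity
  and, later, truncation to finitely many coefficients uniformly in the angle.\<close>

lemma transfer_uniform_limit:
  assumes "h \<in> multiplier_coeffs P"
  shows "uniform_limit UNIV (\<lambda>S \<omega>. \<Sum>i\<in>S. complex_of_real (h i) * cis (- (\<omega> * of_int i)))
    (transfer h) (finite_subsets_at_top UNIV)"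
  unfolding transfer_def
  by (rule Weierstrass_m_test_general[where M = "\<lambda>i. \<bar>h i\<bar>"])
    (auto simp: norm_mult multiplier_coeffs_abs_summable[OF assms])

lemma transfer_continuous:
  assumes "h \<in> multiplier_coeffs P"
  shows "continuous_on UNIV (transfer h)"
  by (rule uniform_limit_theorem[OF _ transfer_uniform_limit[OF assms]])
    (auto intro!: always_eventually continuous_intros)

lemma norm_transfer_le:
  assumes "h \<in> multiplier_coeffs P"
  shows "norm (transfer h \<omega>) \<le> 1"
proof -
  have "norm (transfer h \<omega>) \<le> (\<Sum>\<^sub>\<infinity>i\<in>UNIV. \<bar>h i\<bar>)"
    using multiplier_coeffs_abs_summable[OF assms]
    by (intro norm_infsum_le[OF transfer_has_sum[OF assms]]) (auto simp: norm_mult)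
  then show ?thesis using assms by (simp add: multiplier_coeffs_def l1_norm_le_1_def)
qed

lemma transfer_minus: "transfer h (- \<omega>) = cnj (transfer h \<omega>)"
  unfolding transfer_def by (subst infsum_cnj[symmetric]) (simp add: cis_cnj)

lemma has_sum_finite_sum:
  fixes f :: "'a \<Rightarrow> 'b \<Rightarrow> 'c :: topological_comm_monoid_add"
  assumes "finite A" "\<And>a. a \<in> A \<Longrightarrow> (f a has_sum s a) B"
  shows "((\<lambda>x. \<Sum>a\<in>A. f a x) has_sum (\<Sum>a\<in>A. s a)) B"
  using assms by (induction A rule: finite_induct) (auto intro!: has_sum_add)

text \<open>The triangle inequality and total weight 1 preserve the norm bound, and nonnegative
  weights preserve the sign constraint. Linearity of the series then lets mixtures of loop gains be
  realised by one multiplier.\<close>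

lemma multiplier_coeffs_convex:
  fixes w :: "nat \<Rightarrow> real"
  assumes A: "finite A" and w: "\<And>a. a \<in> A \<Longrightarrow> 0 \<le> w a" "sum w A = 1"
    and e: "\<And>a. a \<in> A \<Longrightarrow> e a \<in> multiplier_coeffs P" and P: "P = {0..} \<or> P = UNIV"
  shows "(\<lambda>i. \<Sum>a\<in>A. w a * e a i) \<in> multiplier_coeffs P"
    and "transfer (\<lambda>i. \<Sum>a\<in>A. w a * e a i) \<omega> = (\<Sum>a\<in>A. w a * transfer (e a) \<omega>)"
proof -
  let ?k = "\<lambda>i. \<Sum>a\<in>A. w a * e a i"
  \<comment> \<open>This series dominates the mixture termwise, giving both its summability and its
    norm bound.\<close>
  have s: "((\<lambda>i. \<Sum>a\<in>A. w a * \<bar>e a i\<bar>) has_sum (\<Sum>a\<in>A. w a * (\<Sum>\<^sub>\<infinity>i. \<bar>e a i\<bar>))) UNIV"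
    using A multiplier_coeffs_abs_summable[OF e]
    by (intro has_sum_finite_sum has_sum_cmult_right has_sum_infsum) auto
  have le: "\<bar>?k i\<bar> \<le> (\<Sum>a\<in>A. w a * \<bar>e a i\<bar>)" for i
    using w(1) by (intro order_trans[OF sum_abs] sum_mono) (auto simp: abs_mult)
  have ks: "(\<lambda>i. \<bar>?k i\<bar>) summable_on UNIV"
    using Infinite_Sum.abs_summable_on_comparison_test'[OF has_sum_imp_summable[OF s], of ?k] le by simp
  have "(\<Sum>\<^sub>\<infinity>i. \<bar>?k i\<bar>) \<le> (\<Sum>a\<in>A. w a * (\<Sum>\<^sub>\<infinity>i. \<bar>e a i\<bar>))"
    using has_sum_mono[OF has_sum_infsum[OF ks] s] le by simp
  also have "\<dots> \<le> (\<Sum>a\<in>A. w a * 1)"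
    using w(1) e by (intro sum_mono mult_left_mono) (auto simp: multiplier_coeffs_def l1_norm_le_1_def)
  finally have "l1_norm_le_1 ?k" using ks w(2) by (simp add: l1_norm_le_1_def)
  moreover have "?k i \<in> P" for i
    using P
  proof
    assume "P = {0..}"
    then show ?thesis using w(1) e by (auto simp: multiplier_coeffs_def intro!: sum_nonneg)
  qed simp
  moreover have "?k 0 = 0" using e by (auto simp: multiplier_coeffs_def)
  ultimately show "?k \<in> multiplier_coeffs P" by (simp add: multiplier_coeffs_def)
  have "((\<lambda>i. \<Sum>a\<in>A. w a * (complex_of_real (e a i) * cis (- (\<omega> * of_int i)))) has_sum
      (\<Sum>a\<in>A. w a * transfer (e a) \<omega>)) UNIV"
    using A transfer_has_sum[OF e] by (intro has_sum_finite_sum has_sum_cmult_right) auto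
  moreover have "(\<lambda>i. \<Sum>a\<in>A. w a * (complex_of_real (e a i) * cis (- (\<omega> * of_int i)))) =
      (\<lambda>i. complex_of_real (?k i) * cis (- (\<omega> * of_int i)))"
    by (simp add: sum_distrib_right mult.assoc)
  ultimately show "transfer ?k \<omega> = (\<Sum>a\<in>A. w a * transfer (e a) \<omega>)"
    unfolding transfer_def[of ?k] by (simp add: infsumI)
qed

section \<open>Extreme multipliers and regularity of loop gains\<close>

text \<open>Coefficients of the extreme multipliers: \<open>s = 0\<close> gives \<open>1\<close>,
  while \<open>s = 1\<close> and \<open>s = -1\<close> give \<open>1 - z^(-k)\<close> and
  \<open>1 + z^(-k)\<close>.\<close>

definition atom :: "int \<Rightarrow> real \<Rightarrow> int \<Rightarrow> real" where
  "atom k s = (\<lambda>i. if i = k then s else 0)"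

lemma atom_in_multiplier_coeffs:
  assumes "k \<noteq> 0 \<or> s = 0" "\<bar>s\<bar> \<le> 1" "s \<in> P" "0 \<in> P"
  shows "atom k s \<in> multiplier_coeffs P"
proof -
  have "((\<lambda>i. \<bar>atom k s i\<bar>) has_sum \<bar>s\<bar>) UNIV"
    by (rule has_sum_finite_neutralI[of "{k}"]) (auto simp: atom_def)
  then have "l1_norm_le_1 (atom k s)"
    using assms(2) by (auto simp: l1_norm_le_1_def has_sum_iff)
  then show ?thesis using assms by (auto simp: multiplier_coeffs_def atom_def)
qed

lemma transfer_atom: "transfer (atom k s) \<omega> = s * cis (- (\<omega> * of_int k))"
proof -
  have "((\<lambda>i. complex_of_real (atom k s i) * cis (- (\<omega> * of_int i))) has_sum
      s * cis (- (\<omega> * of_int k))) UNIV"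
    by (rule has_sum_finite_neutralI[of "{k}"]) (auto simp: atom_def)
  then show ?thesis unfolding transfer_def by (rule infsumI)
qed

lemma RH_inf_cnj:
  assumes "G \<in> RH_inf"
  shows "G (cnj z) = cnj (G z)"
proof -
  have "poly (map_poly complex_of_real p) (cnj z) = cnj (poly (map_poly complex_of_real p) z)" for p
    by (subst poly_cnj_real) (auto simp: coeff_map_poly)
  then show ?thesis using assms by (auto simp: RH_inf_def)
qed

lemma RH_inf_continuous_circle:
  assumes "G \<in> RH_inf"
  shows "continuous_on (sphere 0 1) G"
proof -
  obtain p q :: "real poly" where
    q: "\<And>z. poly (map_poly complex_of_real q) z = 0 \<Longrightarrow> norm z < 1" and
    G: "\<And>z. G z = poly (map_poly complex_of_real p) z / poly (map_poly complex_of_real q) z"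
    using assms unfolding RH_inf_def by blast
  have "continuous_on (sphere 0 1)
      (\<lambda>z. poly (map_poly complex_of_real p) z / poly (map_poly complex_of_real q) z)"
    using q by (intro continuous_intros) force
  then show ?thesis by (simp add: G[abs_def])
qed

text \<open>Since \<open>h\<close> and the polynomials of \<open>G\<close> are real, reversing the
  angle conjugates the product. This evenness links \<open>[0, pi]\<close> with
  \<open>[-pi, pi]\<close>.\<close>

lemma loop_gain_minus:
  assumes "G \<in> RH_inf"
  shows "loop_gain G h (- \<omega>) = loop_gain G h \<omega>"
proof -
  have "(1 - transfer h (- \<omega>)) * G (cis (- \<omega>)) = cnj ((1 - transfer h \<omega>) * G (cis \<omega>))"
    by (simp add: transfer_minus RH_inf_cnj[OF assms] flip: cis_cnj)
  then show ?thesis unfolding loop_gain_def by (metis cnj.sel(1))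
qed

lemma RH_inf_continuous_cis:
  assumes "G \<in> RH_inf"
  shows "continuous_on UNIV (\<lambda>\<omega>. G (cis \<omega>))"
  by (rule continuous_on_compose2[OF RH_inf_continuous_circle[OF assms]])
    (auto intro!: continuous_intros)

lemma loop_gain_isCont:
  assumes "G \<in> RH_inf" "h \<in> multiplier_coeffs P"
  shows "isCont (loop_gain G h) \<omega>"
proof -
  have "continuous_on UNIV (loop_gain G h)"
    unfolding loop_gain_def
    by (intro continuous_intros transfer_continuous[OF assms(2)] RH_inf_continuous_cis[OF assms(1)])
  then show ?thesis by (simp add: continuous_on_eq_continuous_at)
qed

lemma RH_inf_bounded_cis:
  assumes "G \<in> RH_inf"
  obtains B where "\<And>\<omega>. norm (G (cis \<omega>)) \<le> B" "0 < B"
proof -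
  have "bounded (G ` sphere 0 1)"
    using RH_inf_continuous_circle[OF assms] by (intro compact_imp_bounded compact_continuous_image) auto
  then obtain B where "0 < B" "\<And>z. z \<in> sphere 0 1 \<Longrightarrow> norm (G z) \<le> B"
    unfolding bounded_pos by blast
  then show thesis using that[of B] by simp
qed

lemma loop_gain_bounded:
  assumes "h \<in> multiplier_coeffs P" "\<And>\<omega>. norm (G (cis \<omega>)) \<le> B"
  shows "\<bar>loop_gain G h \<omega>\<bar> \<le> 2 * B"
proof -
  have "\<bar>loop_gain G h \<omega>\<bar> \<le> norm (1 - transfer h \<omega>) * norm (G (cis \<omega>))"
    unfolding loop_gain_def norm_mult[symmetric] by (rule abs_Re_le_cmod)
  also have "norm (1 - transfer h \<omega>) \<le> 2"
    using norm_triangle_ineq4[of 1 "transfer h \<omega>"] norm_transfer_le[OF assms(1), of \<omega>] by simp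
  then have "norm (1 - transfer h \<omega>) * norm (G (cis \<omega>)) \<le> 2 * B"
    using assms(2)[of \<omega>] by (intro mult_mono) auto
  finally show ?thesis .
qed

section \<open>Measures with nonpositive loop gain integrals\<close>

text \<open>The integral equals \<open>c\<close> minus the sum of \<open>h i * a i\<close>, for the
  moments \<open>c\<close> and \<open>a i\<close> below. The extreme multipliers give
  \<open>c \<le> 0\<close> and \<open>c \<le> s * a i\<close> for admissible signs \<open>s\<close>,
  so that sum is at least \<open>c\<close> times the norm of \<open>h\<close>, hence at least
  \<open>c\<close>.\<close>

lemma (in real_distribution) loop_gain_integral_nonpos:
  assumes G: "G \<in> RH_inf" and P: "P = {0..} \<or> P = UNIV" and h: "h \<in> multiplier_coeffs P"
    and atom0: "(\<integral>\<omega>. loop_gain G (atom 0 0) \<omega> \<partial>M) \<le> 0"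
    and atoms: "\<And>k s. k \<noteq> 0 \<Longrightarrow> s \<in> {1, -1} \<inter> P \<Longrightarrow> (\<integral>\<omega>. loop_gain G (atom k s) \<omega> \<partial>M) \<le> 0"
  shows "(\<integral>\<omega>. loop_gain G h \<omega> \<partial>M) \<le> 0"
proof -
  obtain B where B: "\<And>\<omega>. norm (G (cis \<omega>)) \<le> B" "0 < B" using RH_inf_bounded_cis[OF G] by metis
  define g where "g k \<omega> = Re (cis (- (\<omega> * of_int k)) * G (cis \<omega>))" for k :: int and \<omega>
  define a where "a k = (\<integral>\<omega>. g k \<omega> \<partial>M)" for k
  define c where "c = (\<integral>\<omega>. Re (G (cis \<omega>)) \<partial>M)"
  have intI: "integrable M f" if "continuous_on UNIV f" "\<And>x. \<bar>f x\<bar> \<le> C" for f :: "real \<Rightarrow> real" and C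
    using that borel_measurable_continuous_onI[OF that(1)]
    by (intro integrable_const_bound[of _ C]) auto
  have g_int: "integrable M (g k)" for k
  proof (rule intI)
    show "continuous_on UNIV (g k)" unfolding g_def
      by (intro continuous_intros RH_inf_continuous_cis[OF G])
    show "\<bar>g k \<omega>\<bar> \<le> B" for \<omega>
      using abs_Re_le_cmod[of "cis (- (\<omega> * of_int k)) * G (cis \<omega>)"] B(1)[of \<omega>]
      by (simp add: g_def norm_mult)
  qed
  have G_int: "integrable M (\<lambda>\<omega>. Re (G (cis \<omega>)))"
    using RH_inf_continuous_cis[OF G] order_trans[OF abs_Re_le_cmod B(1)]
    by (intro intI[of _ B] continuous_intros) auto
  have h_int: "integrable M (loop_gain G h)"
    using loop_gain_isCont[OF G h] loop_gain_bounded[where G = G, OF h B(1)]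
    by (intro intI[of _ "2 * B"]) (auto simp: continuous_on_eq_continuous_at)
  have "loop_gain G (atom k s) \<omega> = Re (G (cis \<omega>)) - s * g k \<omega>" for k s \<omega>
    by (simp add: loop_gain_def transfer_atom g_def algebra_simps)
  then have atom_int: "(\<integral>\<omega>. loop_gain G (atom k s) \<omega> \<partial>M) = c - s * a k" for k s
    using g_int G_int by (simp add: a_def c_def)
  have "c \<le> 0" using atom0 by (simp add: atom_int)
  have term_bound: "c * \<bar>h i\<bar> \<le> h i * a i" for i
  proof (cases "h i = 0")
    case False
    \<comment> \<open>The sign of \<open>h i\<close> selects the extreme multiplier; under the
      constraint \<open>{0..}\<close> it can only be 1.\<close>
    then have "i \<noteq> 0" "sgn (h i) \<in> {1, -1} \<inter> P"
      using h P by (auto simp: multiplier_coeffs_def sgn_real_def split: if_splits dest: spec[of _ i])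
    then have "c \<le> sgn (h i) * a i" using atoms[of i "sgn (h i)"] by (simp add: atom_int)
    then have "c * \<bar>h i\<bar> \<le> sgn (h i) * a i * \<bar>h i\<bar>" by (intro mult_right_mono) auto
    also have "\<dots> = h i * a i" by (simp add: sgn_real_def)
    finally show ?thesis .
  qed simp
  have "(\<integral>\<omega>. loop_gain G h \<omega> \<partial>M) \<le> 0 + \<epsilon>" if "0 < \<epsilon>" for \<epsilon>
  proof -
    \<comment> \<open>Truncating within \<open>\<epsilon> / B\<close> costs at most
      \<open>\<epsilon>\<close> after multiplication by \<open>G\<close>, so only finite sums are
      exchanged with the integral.\<close>
    have "\<forall>\<^sub>F S in finite_subsets_at_top UNIV. \<forall>\<omega>\<in>UNIV.
        dist (\<Sum>i\<in>S. complex_of_real (h i) * cis (- (\<omega> * of_int i))) (transfer h \<omega>) < \<epsilon> / B"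
      using transfer_uniform_limit[OF h] that B(2) by (intro uniform_limitD) auto
    then obtain S where S: "finite S" and approx: "\<And>\<omega>.
        dist (\<Sum>i\<in>S. complex_of_real (h i) * cis (- (\<omega> * of_int i))) (transfer h \<omega>) < \<epsilon> / B"
      unfolding eventually_finite_subsets_at_top by auto
    have le: "loop_gain G h \<omega> \<le> Re (G (cis \<omega>)) - (\<Sum>i\<in>S. h i * g i \<omega>) + \<epsilon>" for \<omega>
    proof -
      let ?t = "\<Sum>i\<in>S. complex_of_real (h i) * cis (- (\<omega> * of_int i))"
      have "loop_gain G h \<omega> = Re (G (cis \<omega>)) - Re (?t * G (cis \<omega>)) + Re ((?t - transfer h \<omega>) * G (cis \<omega>))"
        by (simp add: loop_gain_def algebra_simps)
      also have "Re (?t * G (cis \<omega>)) = (\<Sum>i\<in>S. h i * g i \<omega>)"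
        by (simp add: sum_distrib_right g_def mult.assoc Re_sum del: times_complex.sel)
           (simp add: algebra_simps)
      also have "Re ((?t - transfer h \<omega>) * G (cis \<omega>)) \<le> norm (?t - transfer h \<omega>) * norm (G (cis \<omega>))"
        unfolding norm_mult[symmetric] by (rule complex_Re_le_cmod)
      also have "\<dots> \<le> \<epsilon> / B * B"
        using approx[of \<omega>] B that by (intro mult_mono) (auto simp: dist_norm)
      finally show ?thesis using B(2) by simp
    qed
    have "(\<integral>\<omega>. loop_gain G h \<omega> \<partial>M) \<le>
        (\<integral>\<omega>. Re (G (cis \<omega>)) - (\<Sum>i\<in>S. h i * g i \<omega>) + \<epsilon> \<partial>M)"
      using h_int G_int g_int le by (intro integral_mono) auto
    also have "\<dots> = c - (\<Sum>i\<in>S. h i * a i) + \<epsilon>"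
      using G_int g_int by (simp add: a_def c_def prob_space[simplified])
    finally have "(\<integral>\<omega>. loop_gain G h \<omega> \<partial>M) \<le> c - (\<Sum>i\<in>S. h i * a i) + \<epsilon>" .
    moreover have "(\<Sum>i\<in>S. h i * a i) \<ge> (\<Sum>i\<in>S. c * \<bar>h i\<bar>)"
      by (rule sum_mono) (rule term_bound)
    \<comment> \<open>As \<open>c \<le> 0\<close>, multiplying the norm bound by \<open>c\<close>
      reverses it.\<close>
    moreover have "(\<Sum>i\<in>S. c * \<bar>h i\<bar>) \<ge> c"
    proof -
      have "(\<Sum>i\<in>S. \<bar>h i\<bar>) \<le> (\<Sum>\<^sub>\<infinity>i. \<bar>h i\<bar>)"
        using S multiplier_coeffs_abs_summable[OF h] by (intro finite_sum_le_infsum) auto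
      also have "\<dots> \<le> 1" using h by (simp add: multiplier_coeffs_def l1_norm_le_1_def)
      finally show ?thesis
        using \<open>c \<le> 0\<close> mult_left_mono_neg[of "\<Sum>i\<in>S. \<bar>h i\<bar>" 1 c] by (simp add: sum_distrib_left)
    qed
    ultimately show ?thesis by linarith
  qed
  then show ?thesis by (rule field_le_epsilon)
qed

text \<open>By convexity, a normalised nonnegative combination of extreme loop gains is itself a
  loop gain, hence nonpositive somewhere. This is the reply needed against the countable family of
  extreme multipliers.\<close>

lemma no_positive_multiplier_imp_measure:
  assumes G: "G \<in> RH_inf" and P: "P = {0..} \<or> P = UNIV"
    and none: "\<And>h. h \<in> multiplier_coeffs P \<Longrightarrow> \<exists>\<omega>\<in>{0..pi}. loop_gain G h \<omega> \<le> 0"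
  obtains M where "real_distribution M" "AE \<omega> in M. \<omega> \<in> {0..pi}"
    "\<And>h. h \<in> multiplier_coeffs P \<Longrightarrow> (\<integral>\<omega>. loop_gain G h \<omega> \<partial>M) \<le> 0"
proof -
  define E where "E = insert (atom 0 0) ((\<lambda>(k, s). atom k s) ` ((- {0}) \<times> ({1, -1} \<inter> P)))"
  have EP: "E \<subseteq> multiplier_coeffs P"
    using P by (auto simp: E_def intro!: atom_in_multiplier_coeffs)
  have "countable E" "E \<noteq> {}" by (auto simp: E_def)
  then have range_E: "range (from_nat_into E) = E" by (rule range_from_nat_into[rotated])
  define e where "e = from_nat_into E"
  have e: "e n \<in> multiplier_coeffs P" for n
    using EP from_nat_into[OF \<open>E \<noteq> {}\<close>] by (auto simp: e_def)
  obtain B where B: "\<And>\<omega>. norm (G (cis \<omega>)) \<le> B" using RH_inf_bounded_cis[OF G] by metis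
  obtain M where M: "real_distribution M" "AE \<omega> in M. \<omega> \<in> {0..pi}"
    "\<And>n. (\<integral>\<omega>. loop_gain G (e n) \<omega> \<partial>M) \<le> 0"
  proof (rule countable_alternative_measure[of "\<lambda>n. loop_gain G (e n)" "2 * B" 0 pi])
    fix A :: "nat set" and w :: "nat \<Rightarrow> real"
    assume A: "finite A" and w: "\<And>n. n \<in> A \<Longrightarrow> 0 \<le> w n"
    show "\<exists>\<omega>\<in>{0..pi}. (\<Sum>n\<in>A. w n * loop_gain G (e n) \<omega>) \<le> 0"
    proof (cases "sum w A = 0")
      \<comment> \<open>Zero total weight cannot be normalised, but then the combination vanishes
        everywhere and any angle serves.\<close>
      case True
      then have "\<And>n. n \<in> A \<Longrightarrow> w n = 0" using A w by (simp add: sum_nonneg_eq_0_iff)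
      then show ?thesis by (intro bexI[of _ 0]) auto
    next
      case False
      define W where "W = sum w A"
      have W: "0 < W" using False w sum_nonneg[of A w] by (simp add: W_def less_le)
      define v where "v n = w n / W" for n
      have v: "\<And>n. n \<in> A \<Longrightarrow> 0 \<le> v n" "sum v A = 1"
        using w W by (auto simp: v_def W_def simp flip: sum_divide_distrib)
      define k where "k i = (\<Sum>n\<in>A. v n * e n i)" for i
      have k: "k \<in> multiplier_coeffs P" "\<And>\<omega>. transfer k \<omega> = (\<Sum>n\<in>A. v n * transfer (e n) \<omega>)"
        unfolding k_def using multiplier_coeffs_convex[OF A v e P] by auto
      obtain \<omega> where \<omega>: "\<omega> \<in> {0..pi}" "loop_gain G k \<omega> \<le> 0" using none[OF k(1)] by blast
      \<comment> \<open>Weights summing to 1 absorb the constant 1, turning an affine expression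
        into a convex combination.\<close>
      have "1 - transfer k \<omega> = (\<Sum>n\<in>A. v n * (1 - transfer (e n) \<omega>))"
        using v(2) by (simp add: k(2) right_diff_distrib sum_subtractf flip: of_real_sum)
      then have "loop_gain G k \<omega> = (\<Sum>n\<in>A. v n * loop_gain G (e n) \<omega>)"
        by (simp add: loop_gain_def sum_distrib_right mult.assoc Re_sum del: times_complex.sel)
           (simp add: algebra_simps)
      also have "\<dots> = (\<Sum>n\<in>A. w n * loop_gain G (e n) \<omega>) / W"
        by (simp add: v_def sum_divide_distrib)
      finally show ?thesis using \<omega> W by (auto simp: divide_le_0_iff)
    qed
  qed (auto simp: loop_gain_isCont[OF G e] loop_gain_bounded[where G = G, OF e B])
  have E_int: "(\<integral>\<omega>. loop_gain G h \<omega> \<partial>M) \<le> 0" if "h \<in> E" for h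
    using that range_E M(3) unfolding e_def by (metis rangeE)
  interpret real_distribution M by fact
  have "(\<integral>\<omega>. loop_gain G h \<omega> \<partial>M) \<le> 0" if "h \<in> multiplier_coeffs P" for h
    by (rule loop_gain_integral_nonpos[OF G P that]; rule E_int; force simp: E_def)
  then show thesis using that M by blast
qed

section \<open>Nonzero integrators and the equivalence\<close>

text \<open>Oddness reflects monotonicity to the left half, and the halves fit together because
  \<open>Z 0 = 0\<close>.\<close>

lemma P_NBV_mono_on:
  assumes "Z \<in> P_NBV"
  shows "mono_on {- pi..pi} Z"
proof (rule mono_onI)
  fix x y assume xy: "x \<in> {- pi..pi}" "y \<in> {- pi..pi}" "x \<le> y"
  have mono: "\<And>u v. 0 \<le> u \<Longrightarrow> u \<le> v \<Longrightarrow> v \<le> pi \<Longrightarrow> Z u \<le> Z v"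
    and odd: "\<And>u. 0 \<le> u \<Longrightarrow> u \<le> pi \<Longrightarrow> Z (- u) = - Z u" and "Z 0 = 0"
    using assms by (auto simp: P_NBV_def intro: mono_onD)
  consider "0 \<le> x" | "y \<le> 0" | "x < 0" "0 < y" by linarith
  then show "Z x \<le> Z y"
  proof cases
    case 1
    then show ?thesis using xy mono by auto
  next
    case 2
    then show ?thesis using xy mono[of "- y" "- x"] odd[of "- y"] odd[of "- x"] by auto
  next
    case 3
    then show ?thesis
      using xy mono[of 0 y] mono[of 0 "- x"] odd[of "- x"] \<open>Z 0 = 0\<close> by auto
  qed
qed

text \<open>By compactness and evenness the loop gain has a positive lower bound on
  \<open>[-pi, pi]\<close>, and the integral is at least this bound times the total increment of
  \<open>Z\<close>.\<close>

lemma positive_multiplier_excludes_rs_integral: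
  assumes G: "G \<in> RH_inf" and h: "h \<in> multiplier_coeffs P"
    and pos: "\<And>\<omega>. \<omega> \<in> {0..pi} \<Longrightarrow> 0 < loop_gain G h \<omega>"
    and Z: "Z \<in> P_NBV" "\<omega>\<^sub>0 \<in> {- pi..pi}" "Z \<omega>\<^sub>0 \<noteq> 0"
    and I: "has_rs_integral (loop_gain G h) Z (- pi) pi I"
  shows "0 < I"
proof -
  have "continuous_on {0..pi} (loop_gain G h)"
    using loop_gain_isCont[OF G h] by (simp add: continuous_at_imp_continuous_on)
  then obtain x where x: "x \<in> {0..pi}" "\<And>\<omega>. \<omega> \<in> {0..pi} \<Longrightarrow> loop_gain G h x \<le> loop_gain G h \<omega>"
    using continuous_attains_inf[of "{0..pi}" "loop_gain G h"] by (auto simp: atLeastatMost_empty_iff)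
  have "loop_gain G h x \<le> loop_gain G h \<omega>" if "\<omega> \<in> {- pi..pi}" for \<omega>
    using x(2)[of "\<bar>\<omega>\<bar>"] that loop_gain_minus[OF G, of h \<omega>] by (cases "\<omega> \<ge> 0") auto
  then have "loop_gain G h x * (Z pi - Z (- pi)) \<le> I"
    by (intro has_rs_integral_lower_bound[OF I _ P_NBV_mono_on[OF Z(1)]]) auto
  \<comment> \<open>Were the total increment not positive, oddness and monotonicity would squeeze
    \<open>Z \<omega>\<^sub>0\<close> to 0.\<close>
  moreover have "0 < Z pi - Z (- pi)"
  proof -
    have "Z (- pi) \<le> Z \<omega>\<^sub>0" "Z \<omega>\<^sub>0 \<le> Z pi"
      using P_NBV_mono_on[OF Z(1)] Z(2) by (auto intro: mono_onD)
    moreover have "Z (- pi) = - Z pi" using Z(1) by (auto simp: P_NBV_def)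
    ultimately show ?thesis using Z(3) by linarith
  qed
  ultimately show ?thesis using mult_pos_pos[OF pos[OF x(1)]] by (meson less_le_trans)
qed

theorem corollary2:
  fixes G :: "complex \<Rightarrow> complex" and N :: "(complex \<Rightarrow> complex) set"
  assumes "G \<in> RH_inf"
    and "N = zames_falb \<or> N = zames_falb_odd"
  shows "(\<not> (\<exists>M\<in>N. \<forall>\<omega>\<in>{0..pi}. Re (M (cis \<omega>) * G (cis \<omega>)) > 0)) \<longleftrightarrow>
    (\<exists>Z\<in>P_NBV. (\<exists>\<omega>\<in>{- pi..pi}. Z \<omega> \<noteq> 0) \<and>
       (\<forall>M\<in>N. \<exists>I. has_rs_integral (\<lambda>\<omega>. Re (M (cis \<omega>) * G (cis \<omega>))) Z (- pi) pi I \<and> I \<le> 0))"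
proof -
  note G = assms(1)
  obtain P where P: "P = {0..} \<or> P = UNIV"
    and N: "N = {M. \<exists>h\<in>multiplier_coeffs P. is_multiplier_of M h}"
    using assms(2) zames_falb_eq_multiplier_coeffs zames_falb_odd_eq_multiplier_coeffs by metis
  have gain: "Re (M (cis \<omega>) * G (cis \<omega>)) = loop_gain G h \<omega>" if "is_multiplier_of M h" for M h \<omega>
    using that by (simp add: is_multiplier_of_iff loop_gain_def)
  \<comment> \<open>Every admissible \<open>h\<close> is realised by some multiplier, so quantifiers
    over \<open>N\<close> become quantifiers over coefficients, here and in
    \<open>rhs\<close>.\<close>
  have lhs: "(\<exists>M\<in>N. \<forall>\<omega>\<in>{0..pi}. Re (M (cis \<omega>) * G (cis \<omega>)) > 0) \<longleftrightarrow>
      (\<exists>h\<in>multiplier_coeffs P. \<forall>\<omega>\<in>{0..pi}. 0 < loop_gain G h \<omega>)"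
  proof
    assume "\<exists>h\<in>multiplier_coeffs P. \<forall>\<omega>\<in>{0..pi}. 0 < loop_gain G h \<omega>"
    then obtain h where h: "h \<in> multiplier_coeffs P" "\<forall>\<omega>\<in>{0..pi}. 0 < loop_gain G h \<omega>" by blast
    obtain M where "is_multiplier_of M h" by (rule multiplier_exists)
    then show "\<exists>M\<in>N. \<forall>\<omega>\<in>{0..pi}. Re (M (cis \<omega>) * G (cis \<omega>)) > 0"
      using h by (intro bexI[of _ M]) (auto simp: N gain simp del: times_complex.sel)
  next
    assume "\<exists>M\<in>N. \<forall>\<omega>\<in>{0..pi}. Re (M (cis \<omega>) * G (cis \<omega>)) > 0"
    then obtain M h where "h \<in> multiplier_coeffs P" "is_multiplier_of M h"
      "\<forall>\<omega>\<in>{0..pi}. Re (M (cis \<omega>) * G (cis \<omega>)) > 0" unfolding N by blast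
    then show "\<exists>h\<in>multiplier_coeffs P. \<forall>\<omega>\<in>{0..pi}. 0 < loop_gain G h \<omega>"
      by (intro bexI[of _ h]) (auto simp: gain simp del: times_complex.sel)
  qed
  have rhs: "(\<forall>M\<in>N. \<exists>I. has_rs_integral (\<lambda>\<omega>. Re (M (cis \<omega>) * G (cis \<omega>))) Z (- pi) pi I \<and> I \<le> 0) \<longleftrightarrow>
      (\<forall>h\<in>multiplier_coeffs P. \<exists>I. has_rs_integral (loop_gain G h) Z (- pi) pi I \<and> I \<le> 0)" for Z
  proof -
    have eq: "(\<lambda>\<omega>. Re (M (cis \<omega>) * G (cis \<omega>))) = loop_gain G h" if "is_multiplier_of M h" for M h
      using gain[OF that] by auto
    show ?thesis
      unfolding N
    proof (intro iffI ballI)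
      fix h assume *: "\<forall>M\<in>{M. \<exists>h\<in>multiplier_coeffs P. is_multiplier_of M h}.
        \<exists>I. has_rs_integral (\<lambda>\<omega>. Re (M (cis \<omega>) * G (cis \<omega>))) Z (- pi) pi I \<and> I \<le> 0"
        and h: "h \<in> multiplier_coeffs P"
      obtain M where M: "is_multiplier_of M h" by (rule multiplier_exists)
      with * h have "\<exists>I. has_rs_integral (\<lambda>\<omega>. Re (M (cis \<omega>) * G (cis \<omega>))) Z (- pi) pi I \<and> I \<le> 0"
        by blast
      then show "\<exists>I. has_rs_integral (loop_gain G h) Z (- pi) pi I \<and> I \<le> 0" unfolding eq[OF M] .
    next
      fix M assume *: "\<forall>h\<in>multiplier_coeffs P.
          \<exists>I. has_rs_integral (loop_gain G h) Z (- pi) pi I \<and> I \<le> 0"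
        and "M \<in> {M. \<exists>h\<in>multiplier_coeffs P. is_multiplier_of M h}"
      then obtain h where "h \<in> multiplier_coeffs P" and M: "is_multiplier_of M h" by blast
      then show "\<exists>I. has_rs_integral (\<lambda>\<omega>. Re (M (cis \<omega>) * G (cis \<omega>))) Z (- pi) pi I \<and> I \<le> 0"
        unfolding eq[OF M] using * by blast
    qed
  qed
  show ?thesis
    unfolding lhs rhs
  proof
    assume "\<not> (\<exists>h\<in>multiplier_coeffs P. \<forall>\<omega>\<in>{0..pi}. 0 < loop_gain G h \<omega>)"
    then have none: "\<exists>\<omega>\<in>{0..pi}. loop_gain G h \<omega> \<le> 0" if "h \<in> multiplier_coeffs P" for h
      using that by (meson not_less)
    obtain M where M: "real_distribution M" and supp: "AE \<omega> in M. \<omega> \<in> {0..pi}"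
      and int: "\<And>h. h \<in> multiplier_coeffs P \<Longrightarrow> (\<integral>\<omega>. loop_gain G h \<omega> \<partial>M) \<le> 0"
      using no_positive_multiplier_imp_measure[OF G P none] by blast
    interpret real_distribution M by fact
    define Z where "Z = odd_extension (\<lambda>x. measure M {0..x})"
    obtain B where B: "\<And>\<omega>. norm (G (cis \<omega>)) \<le> B" using RH_inf_bounded_cis[OF G] by metis
    \<comment> \<open>The probability measure is carried by \<open>[0, pi]\<close>; this value shows
      that \<open>Z\<close> is nonzero.\<close>
    have "Z pi = 1"
      using supp by (simp add: Z_def odd_extension_def prob_eq_1)
    then have "\<exists>\<omega>\<in>{- pi..pi}. Z \<omega> \<noteq> 0" by (intro bexI[of _ pi]) auto
    moreover have "Z \<in> P_NBV" unfolding Z_def by (rule odd_extension_in_P_NBV)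
    moreover have "has_rs_integral (loop_gain G h) Z (- pi) pi (2 * (\<integral>\<omega>. loop_gain G h \<omega> \<partial>M))"
      if h: "h \<in> multiplier_coeffs P" for h
      unfolding Z_def
      by (rule has_rs_integral_odd_extension[OF pi_gt_zero supp loop_gain_isCont[OF G h]
            loop_gain_bounded[where G = G, OF h B] loop_gain_minus[OF G]])
    ultimately show "\<exists>Z\<in>P_NBV. (\<exists>\<omega>\<in>{- pi..pi}. Z \<omega> \<noteq> 0) \<and> (\<forall>h\<in>multiplier_coeffs P.
        \<exists>I. has_rs_integral (loop_gain G h) Z (- pi) pi I \<and> I \<le> 0)"
      using int by (intro bexI[of _ Z] conjI ballI) (auto intro!: exI)
  next
    assume "\<exists>Z\<in>P_NBV. (\<exists>\<omega>\<in>{- pi..pi}. Z \<omega> \<noteq> 0) \<and> (\<forall>h\<in>multiplier_coeffs P.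
        \<exists>I. has_rs_integral (loop_gain G h) Z (- pi) pi I \<and> I \<le> 0)"
    then obtain Z \<omega>\<^sub>0 where Z: "Z \<in> P_NBV" "\<omega>\<^sub>0 \<in> {- pi..pi}" "Z \<omega>\<^sub>0 \<noteq> 0"
      and I: "\<forall>h\<in>multiplier_coeffs P. \<exists>I. has_rs_integral (loop_gain G h) Z (- pi) pi I \<and> I \<le> 0"
      by blast
    show "\<not> (\<exists>h\<in>multiplier_coeffs P. \<forall>\<omega>\<in>{0..pi}. 0 < loop_gain G h \<omega>)"
    proof
      assume "\<exists>h\<in>multiplier_coeffs P. \<forall>\<omega>\<in>{0..pi}. 0 < loop_gain G h \<omega>"
      then obtain h where h: "h \<in> multiplier_coeffs P" and pos: "\<And>\<omega>. \<omega> \<in> {0..pi} \<Longrightarrow> 0 < loop_gain G h \<omega>"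
        by blast
      obtain I' where "has_rs_integral (loop_gain G h) Z (- pi) pi I'" "I' \<le> 0"
        using I h by blast
      then show False
        using positive_multiplier_excludes_rs_integral[OF G h pos Z] by fastforce
    qed
  qed
qed

end
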